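(* Let $R$ be a commutative ring and $E$ a subset of $\operatorname{Spec}(R)$. Let $\pi: R\to\prod_{\mathfrak{p}\in E}R/\mathfrak{p}$ be the canonical ring map $r\mapsto (r+\mathfrak{p})_{\mathfrak{p}\in E}$, and let $\pi^{\ast}:\operatorname{Spec}\big(\prod_{\mathfrak{p}\in E}R/\mathfrak{p}\big)\to\operatorname{Spec}(R)$ be the induced map. Then $\operatorname{Im}\pi^{\ast}\subseteq\overline{E}$, where $\overline{E}$ denotes the closure of $E$ in $\operatorname{Spec}(R)$ with respect to the Zariski topology.
   Context: All rings are commutative (with identity). A ring map $\phi:A\to B$ induces $\phi^{\ast}:\operatorname{Spec}(B)\to\operatorname{Spec}(A)$, $\phi^{\ast}(\mathfrak{q})=\phi^{-1}(\mathfrak{q})$. *)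

theory Defs
  imports "HOL-Algebra.QuotRing" "HOL-Analysis.Abstract_Topology"
begin

definition Spec :: "('a, 'm) ring_scheme \<Rightarrow> 'a set set"
  where "Spec R = {\<pp>. primeideal \<pp> R}"

definition vanishing :: "('a, 'm) ring_scheme \<Rightarrow> 'a set \<Rightarrow> 'a set set"
  where "vanishing R A = {\<pp> \<in> Spec R. A \<subseteq> \<pp>}"

definition zariski :: "('a, 'm) ring_scheme \<Rightarrow> 'a set topology"
  where "zariski R = topology (\<lambda>U. \<exists>A \<subseteq> carrier R. U = Spec R - vanishing R A)"

text \<open>The codomain ring is not an argument: the preimage of a prime only depends on the carrier of
  the domain \<open>R\<close> and on \<open>\<phi>\<close>.\<close>

definition spec_map :: "('a, 'm) ring_scheme \<Rightarrow> ('a \<Rightarrow> 'b) \<Rightarrow> 'b set \<Rightarrow> 'a set"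
  where "spec_map R \<phi> \<qq> = {r \<in> carrier R. \<phi> r \<in> \<qq>}"

definition product_ring :: "'i set \<Rightarrow> ('i \<Rightarrow> ('b, 'm) ring_scheme) \<Rightarrow> ('i \<Rightarrow> 'b) ring"
  where "product_ring I S =
    \<lparr>carrier = (\<Pi>\<^sub>E i\<in>I. carrier (S i)),
     monoid.mult = (\<lambda>x y. \<lambda>i\<in>I. x i \<otimes>\<^bsub>S i\<^esub> y i),
     one = (\<lambda>i\<in>I. \<one>\<^bsub>S i\<^esub>),
     zero = (\<lambda>i\<in>I. \<zero>\<^bsub>S i\<^esub>),
     add = (\<lambda>x y. \<lambda>i\<in>I. x i \<oplus>\<^bsub>S i\<^esub> y i)\<rparr>"

definition quot_prod :: "('a, 'm) ring_scheme \<Rightarrow> 'a set set \<Rightarrow> ('a set \<Rightarrow> 'a set) ring"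
  where "quot_prod R E = product_ring E (\<lambda>\<pp>. R Quot \<pp>)"

definition canonical_map :: "('a, 'm) ring_scheme \<Rightarrow> 'a set set \<Rightarrow> 'a \<Rightarrow> 'a set \<Rightarrow> 'a set"
  where "canonical_map R E = (\<lambda>r. \<lambda>\<pp>\<in>E. \<pp> +>\<^bsub>R\<^esub> r)"

lemma istopology_zariski:
  assumes "cring R"
  shows "istopology (\<lambda>U. \<exists>A \<subseteq> carrier R. U = Spec R - vanishing R A)"
proof -
  interpret cring R by fact
  let ?P = "\<lambda>U. \<exists>A \<subseteq> carrier R. U = Spec R - vanishing R A"
  have "?P (U \<inter> V)" if UV: "?P U" "?P V" for U V
  proof -
    obtain A B where A: "A \<subseteq> carrier R" "U = Spec R - vanishing R A"
      and B: "B \<subseteq> carrier R" "V = Spec R - vanishing R B"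
      using UV by blast
    let ?C = "{a \<otimes>\<^bsub>R\<^esub> b | a b. a \<in> A \<and> b \<in> B}"
    have "?C \<subseteq> \<pp> \<longleftrightarrow> A \<subseteq> \<pp> \<or> B \<subseteq> \<pp>" if "\<pp> \<in> Spec R" for \<pp>
    proof -
      interpret p: primeideal \<pp> R using that by (simp add: Spec_def)
      show ?thesis
      proof
        assume C: "?C \<subseteq> \<pp>"
        show "A \<subseteq> \<pp> \<or> B \<subseteq> \<pp>"
        proof (rule ccontr)
          assume "\<not> (A \<subseteq> \<pp> \<or> B \<subseteq> \<pp>)"
          then obtain a b where ab: "a \<in> A" "a \<notin> \<pp>" "b \<in> B" "b \<notin> \<pp>" by blast
          moreover have "a \<otimes>\<^bsub>R\<^esub> b \<in> \<pp>" using C ab by blast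
          ultimately show False using p.I_prime A B by blast
        qed
      next
        assume "A \<subseteq> \<pp> \<or> B \<subseteq> \<pp>"
        then show "?C \<subseteq> \<pp>"
          using A B p.I_l_closed p.I_r_closed by blast
      qed
    qed
    then have "U \<inter> V = Spec R - vanishing R ?C"
      unfolding A B vanishing_def by blast
    moreover have "?C \<subseteq> carrier R" using A B by blast
    ultimately show ?thesis by blast
  qed
  moreover have "?P (\<Union>K)" if K: "\<forall>U\<in>K. ?P U" for K
  proof -
    obtain f where f: "\<And>U. U \<in> K \<Longrightarrow> f U \<subseteq> carrier R \<and> U = Spec R - vanishing R (f U)"
      using K by metis
    have "\<Union>K = (\<Union>U\<in>K. Spec R - vanishing R (f U))" using f by auto
    also have "\<dots> = Spec R - vanishing R (\<Union>U\<in>K. f U)"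
      unfolding vanishing_def by blast
    finally have "\<Union>K = Spec R - vanishing R (\<Union>U\<in>K. f U)" .
    moreover have "(\<Union>U\<in>K. f U) \<subseteq> carrier R" using f by blast
    ultimately show ?thesis by blast
  qed
  ultimately show ?thesis unfolding istopology_def by blast
qed

lemma openin_zariski:
  assumes "cring R"
  shows "openin (zariski R) U \<longleftrightarrow> (\<exists>A \<subseteq> carrier R. U = Spec R - vanishing R A)"
  unfolding zariski_def using istopology_zariski[OF assms] by (simp add: topology_inverse')

lemma topspace_zariski:
  assumes "cring R"
  shows "topspace (zariski R) = Spec R"
proof
  show "topspace (zariski R) \<subseteq> Spec R"
    unfolding topspace_def using openin_zariski[OF assms] by blast
  interpret cring R by fact
  have "vanishing R (carrier R) = {}"
    unfolding vanishing_def Spec_def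
    using primeideal.I_notcarr[of _ R] ideal.Icarr[OF primeideal.axioms(1)] by fastforce
  then have "openin (zariski R) (Spec R)"
    using openin_zariski[OF assms] by (metis Diff_empty subset_refl)
  then show "Spec R \<subseteq> topspace (zariski R)" by (rule openin_subset)
qed

lemma closedin_zariski:
  assumes "cring R"
  shows "closedin (zariski R) Z \<longleftrightarrow> (\<exists>A \<subseteq> carrier R. Z = vanishing R A)"
proof -
  have V: "vanishing R A \<subseteq> Spec R" for A by (auto simp: vanishing_def)
  show ?thesis
    unfolding closedin_def topspace_zariski[OF assms] openin_zariski[OF assms]
    using V by (metis double_diff subset_refl)
qed

lemma cring_product_ring:
  assumes "\<And>i. i \<in> I \<Longrightarrow> cring (S i)"
  shows "cring (product_ring I S)"
proof -
  have r: "ring (S i)" if "i \<in> I" for i using assms[OF that] by (simp add: cring.axioms(1))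
  have xi: "x i \<in> carrier (S i)" if "x \<in> (\<Pi>\<^sub>E i\<in>I. carrier (S i))" "i \<in> I" for x i
    using that by (rule PiE_mem)
  have ag: "abelian_group (S i)" if "i \<in> I" for i
    using r[OF that] by (simp add: ring.axioms(1))
  have cm: "Group.comm_monoid (S i)" if "i \<in> I" for i
    using assms[OF that] by (simp add: cring.axioms(2))
  have m: "Group.monoid (S i)" if "i \<in> I" for i
    using cm[OF that] by (simp add: comm_monoid.axioms(1))
  have "abelian_group (product_ring I S)"
  proof (rule abelian_groupI)
    fix x assume x: "x \<in> carrier (product_ring I S)"
    show "\<exists>y\<in>carrier (product_ring I S). y \<oplus>\<^bsub>product_ring I S\<^esub> x = \<zero>\<^bsub>product_ring I S\<^esub>"
    proof (rule bexI)
      let ?y = "\<lambda>i\<in>I. \<ominus>\<^bsub>S i\<^esub> x i"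
      have x': "x \<in> (\<Pi>\<^sub>E i\<in>I. carrier (S i))" using x by (simp add: product_ring_def)
      show "?y \<in> carrier (product_ring I S)"
        using abelian_group.a_inv_closed[OF ag xi[OF x']] by (simp add: product_ring_def)
      show "?y \<oplus>\<^bsub>product_ring I S\<^esub> x = \<zero>\<^bsub>product_ring I S\<^esub>"
        using abelian_group.l_neg[OF ag xi[OF x']] by (auto simp: product_ring_def intro!: restrict_ext)
    qed
  qed (auto simp: product_ring_def xi r ring.ring_simprules fun_eq_iff
      intro: PiE_arb)
  moreover have "Group.comm_monoid (product_ring I S)"
    by (rule Group.comm_monoidI)
      (auto simp: product_ring_def xi m monoid.m_closed monoid.m_assoc monoid.l_one
        comm_monoid.m_comm[OF cm] fun_eq_iff intro: PiE_arb)
  ultimately show ?thesis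
    by (rule cringI)
      (auto simp: product_ring_def xi assms cring.cring_simprules fun_eq_iff)
qed

lemma cring_quot_prod:
  assumes "cring R" "E \<subseteq> Spec R"
  shows "cring (quot_prod R E)"
  unfolding quot_prod_def
  using assms by (intro cring_product_ring ideal.quotient_is_cring)
    (auto simp: Spec_def primeideal.axioms(1))

lemma canonical_map_ring_hom:
  assumes "cring R" "E \<subseteq> Spec R"
  shows "canonical_map R E \<in> ring_hom R (quot_prod R E)"
proof -
  have h: "(+>\<^bsub>R\<^esub>) \<pp> \<in> ring_hom R (R Quot \<pp>)" if "\<pp> \<in> E" for \<pp>
    using that assms(2) by (intro ideal.rcos_ring_hom) (auto simp: Spec_def primeideal.axioms(1))
  show ?thesis
    by (rule ring_hom_memI)
      (auto simp: canonical_map_def quot_prod_def product_ring_def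
        ring_hom_closed[OF h] ring_hom_mult[OF h] ring_hom_add[OF h] ring_hom_one[OF h]
        intro!: restrict_ext)
qed

lemma spec_map_Spec:
  assumes R: "cring R" and S: "cring S" and \<phi>: "\<phi> \<in> ring_hom R S" and q: "\<qq> \<in> Spec S"
  shows "spec_map R \<phi> \<qq> \<in> Spec R"
proof -
  interpret ring_hom_cring R S \<phi>
    using R S \<phi> by (simp add: ring_hom_cring_def ring_hom_cring_axioms_def)
  show ?thesis
    using ring.primeideal_vimage[OF R] q by (simp add: Spec_def spec_map_def)
qed

end

theory Submission
  imports Defs
begin

text \<open>The closure of \<open>E\<close> is closed, so it is \<open>vanishing R A\<close> for
  some \<open>A\<close>. As \<open>E\<close> lies in it, every element of \<open>A\<close> belongs
  to all primes in \<open>E\<close>; its residues all vanish, so the canonical map kills it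
  (\<open>canonical_map_eq_zero\<close>). Zero lies in every prime of the product, hence the
  preimage of such a prime contains \<open>A\<close> and is a point of the closure.\<close>

lemma canonical_map_eq_zero:
  assumes "E \<subseteq> vanishing R A" "a \<in> A"
  shows "canonical_map R E a = \<zero>\<^bsub>quot_prod R E\<^esub>"
proof -
  \<comment> \<open>The zero of \<open>R Quot \<pp>\<close> is the coset \<open>\<pp>\<close>
    itself.\<close>
  have "\<pp> +>\<^bsub>R\<^esub> a = \<pp>" if "\<pp> \<in> E" for \<pp>
  proof -
    interpret primeideal \<pp> R
      using that assms(1) by (auto simp: vanishing_def Spec_def)
    show ?thesis
      using that assms by (intro a_rcos_const) (auto simp: vanishing_def)
  qed
  then show ?thesis
    by (simp add: canonical_map_def quot_prod_def product_ring_def FactRing_def cong: restrict_cong)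
qed

theorem theorem3p5:
  fixes R :: "('a, 'm) ring_scheme" and E :: "'a set set"
  assumes "cring R" and "E \<subseteq> Spec R"
  shows "spec_map R (canonical_map R E) ` Spec (quot_prod R E) \<subseteq> zariski R closure_of E"
proof (rule image_subsetI)
  fix \<qq> assume q: "\<qq> \<in> Spec (quot_prod R E)"
  \<comment> \<open>Any \<open>A\<close> cutting out the closure will do; it need not be the
    intersection of \<open>E\<close>.\<close>
  obtain A where A: "A \<subseteq> carrier R" "zariski R closure_of E = vanishing R A"
    using closedin_zariski[OF assms(1)] closedin_closure_of by meson
  have EA: "E \<subseteq> vanishing R A"
    using closure_of_subset[of E "zariski R"] assms A(2) by (simp add: topspace_zariski)
  interpret q: primeideal \<qq> "quot_prod R E"
    using q by (simp add: Spec_def)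
  \<comment> \<open>Elements of \<open>A\<close> map to zero, which the ideal \<open>\<qq>\<close>
    contains.\<close>
  have "A \<subseteq> spec_map R (canonical_map R E) \<qq>"
    using A(1) by (auto simp: spec_map_def canonical_map_eq_zero[OF EA])
  moreover have "spec_map R (canonical_map R E) \<qq> \<in> Spec R"
    using spec_map_Spec[OF assms(1) cring_quot_prod[OF assms] canonical_map_ring_hom[OF assms] q] .
  ultimately show "spec_map R (canonical_map R E) \<qq> \<in> zariski R closure_of E"
    unfolding A(2) vanishing_def by blast
qed

end
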